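(* Let $\mathcal{A}$ be a finite-dimensional evolution algebra over a field $\mathbb{K}$ with a natural basis $B=\{e_i\}_{i\in\Lambda}$. Then $$\operatorname{ann}^{(i)}(\mathcal{A})=\operatorname{span}\{e_j : j\in\lambda_i(B)\}\quad\text{for all integers } i\ge 1.$$
   Context: An evolution algebra over a field $\mathbb{K}$ (arbitrary characteristic) is a $\mathbb{K}$-algebra $\mathcal{A}$ (not necessarily associative) admitting a basis $B=\{e_i\}_{i\in\Lambda}$, called a natural basis, with $e_ie_j=0$ for $i\neq j$ and $e_i^2=\sum_{k\in\Lambda} w_{ik}e_k$, where $w_{ik}\in\mathbb{K}$. All algebras are finite-dimensional. For $i\in\Lambda$, $D^1(i)=\{k\in\Lambda : w_{ik}\neq 0\}$ (the first-generation descendants of $i$ in the directed graph $\Gamma(\mathcal{A},B)$ with vertex set $\Lambda$ and an arrow $(i,k)$ exactly when $w_{ik}\ne 0$). Define $\lambda_1(B)=\{i\in\Lambda : e_i^2=0\}$ and $\lambda_k(B)=\{i\in\Lambda : D^1(i)\subseteq\lambda_{k-1}(B)\}$ for $k>1$. The annihilator is $\operatorname{ann}(\mathcal{A})=\{x\in\mathcal{A}: x\mathcal{A}=\{0\}\}$. The upper annihilating series is defined by $\operatorname{ann}^{(0)}(\mathcal{A})=\{0\}$ and $\operatorname{ann}^{(i)}(\mathcal{A})/\operatorname{ann}^{(i-1)}(\mathcal{A})=\operatorname{ann}(\mathcal{A}/\operatorname{ann}^{(i-1)}(\mathcal{A}))$ for $i\ge1$. *)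

theory Defs
  imports Complex_Main
begin

text \<open>The underlying vector space is the whole type \<open>'a\<close>. Neither associativity, nor
  commutativity, nor a unit is assumed.\<close>

locale nonassoc_algebra = vector_space scale
  for scale :: "'k::field \<Rightarrow> 'a::ab_group_add \<Rightarrow> 'a"  (infixr \<open>*s\<close> 75) +
  fixes mul :: "'a \<Rightarrow> 'a \<Rightarrow> 'a"  (infixl \<open>\<bullet>\<close> 70)
  assumes mul_add_left: "(x + y) \<bullet> z = x \<bullet> z + y \<bullet> z"
    and mul_add_right: "x \<bullet> (y + z) = x \<bullet> y + x \<bullet> z"
    and mul_scale_left: "(c *s x) \<bullet> y = c *s (x \<bullet> y)"
    and mul_scale_right: "x \<bullet> (c *s y) = c *s (x \<bullet> y)"

text \<open>An evolution algebra together with a natural basis \<open>(e i)\<close>, \<open>i \<in> \<Lambda>\<close>, and its structure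
  constants \<open>w\<close>. Finite-dimensionality is expressed by finiteness of \<open>\<Lambda>\<close>. The values of \<open>e\<close> and
  \<open>w\<close> at indices outside \<open>\<Lambda>\<close> are irrelevant.\<close>

locale evolution_algebra = nonassoc_algebra scale mul
  for scale :: "'k::field \<Rightarrow> 'a::ab_group_add \<Rightarrow> 'a"  (infixr \<open>*s\<close> 75)
    and mul :: "'a \<Rightarrow> 'a \<Rightarrow> 'a"  (infixl \<open>\<bullet>\<close> 70) +
  fixes \<Lambda> :: "'i set" and e :: "'i \<Rightarrow> 'a" and w :: "'i \<Rightarrow> 'i \<Rightarrow> 'k"
  assumes finite_index: "finite \<Lambda>"
    and basis_inj: "inj_on e \<Lambda>"
    and basis_independent: "independent (e ` \<Lambda>)"
    and basis_span: "span (e ` \<Lambda>) = UNIV"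
    and mul_distinct: "\<lbrakk>i \<in> \<Lambda>; j \<in> \<Lambda>; i \<noteq> j\<rbrakk> \<Longrightarrow> e i \<bullet> e j = 0"
    and mul_same: "i \<in> \<Lambda> \<Longrightarrow> e i \<bullet> e i = (\<Sum>k\<in>\<Lambda>. w i k *s e k)"

definition descendants1 :: "'i set \<Rightarrow> ('i \<Rightarrow> 'i \<Rightarrow> 'k::zero) \<Rightarrow> 'i \<Rightarrow> 'i set"
  where "descendants1 \<Lambda> w i = {k \<in> \<Lambda>. w i k \<noteq> 0}"

text \<open>The sets \<open>\<lambda>\<^sub>k(B)\<close> are defined for \<open>k \<ge> 1\<close> only; the value at \<open>0\<close> is a dummy that is not used
  by the other equations.\<close>

fun level_set ::
  "('a \<Rightarrow> 'a \<Rightarrow> 'a::zero) \<Rightarrow> 'i set \<Rightarrow> ('i \<Rightarrow> 'a) \<Rightarrow> ('i \<Rightarrow> 'i \<Rightarrow> 'k::zero) \<Rightarrow> nat \<Rightarrow> 'i set"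
  where
    "level_set mul \<Lambda> e w 0 = {}"
  | "level_set mul \<Lambda> e w (Suc 0) = {i \<in> \<Lambda>. mul (e i) (e i) = 0}"
  | "level_set mul \<Lambda> e w (Suc (Suc k)) =
       {i \<in> \<Lambda>. descendants1 \<Lambda> w i \<subseteq> level_set mul \<Lambda> e w (Suc k)}"

text \<open>The annihilator \<open>{x. x A = 0}\<close> is one-sided; evolution algebras are commutative
  (\<open>mul_commute\<close> below). It is defined for an explicit carrier \<open>C\<close>, multiplication and zero, so that it
  applies both to an algebra (with \<open>C = UNIV\<close>) and to its quotients, whose elements are cosets.\<close>

definition annihilator :: "'b set \<Rightarrow> ('b \<Rightarrow> 'b \<Rightarrow> 'b) \<Rightarrow> 'b \<Rightarrow> 'b set"
  where "annihilator C m z = {x \<in> C. \<forall>y\<in>C. m x y = z}"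

definition coset :: "'a::plus set \<Rightarrow> 'a \<Rightarrow> 'a set"
  where "coset I x = (\<lambda>y. x + y) ` I"

text \<open>For an ideal \<open>I\<close> this is the product of the quotient by \<open>I\<close>; see \<open>coset_mul_coset\<close> below.\<close>

definition coset_mul :: "('a \<Rightarrow> 'a \<Rightarrow> 'a::plus) \<Rightarrow> 'a set \<Rightarrow> 'a set \<Rightarrow> 'a set \<Rightarrow> 'a set"
  where "coset_mul mul I X Y = (\<Union>x\<in>X. \<Union>y\<in>Y. coset I (mul x y))"

definition quotient_annihilator :: "('a \<Rightarrow> 'a \<Rightarrow> 'a::plus) \<Rightarrow> 'a set \<Rightarrow> 'a set set"
  where "quotient_annihilator mul I = annihilator (range (coset I)) (coset_mul mul I) I"

text \<open>\<open>ann\<^sup>(\<^sup>i\<^sup>+\<^sup>1\<^sup>)\<close> is the full preimage of the annihilator of the quotient by \<open>ann\<^sup>(\<^sup>i\<^sup>)\<close> under the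
  canonical projection. The lemmas \<open>upper_ann_ideal\<close>, \<open>upper_ann_quotient\<close> and
  \<open>upper_ann_unique\<close> below show that, in a commutative algebra, it is an ideal and the only
  subspace \<open>S \<supseteq> ann\<^sup>(\<^sup>i\<^sup>)\<close> with
  \<open>S / ann\<^sup>(\<^sup>i\<^sup>) = ann (A / ann\<^sup>(\<^sup>i\<^sup>))\<close>.\<close>

primrec upper_ann :: "('a \<Rightarrow> 'a \<Rightarrow> 'a::monoid_add) \<Rightarrow> nat \<Rightarrow> 'a set"
  where
    "upper_ann mul 0 = {0}"
  | "upper_ann mul (Suc i) = {x. coset (upper_ann mul i) x \<in> quotient_annihilator mul (upper_ann mul i)}"

context nonassoc_algebra
begin

definition is_ideal :: "'a set \<Rightarrow> bool"
  where "is_ideal I \<longleftrightarrow> subspace I \<and> (\<forall>x\<in>I. \<forall>y. x \<bullet> y \<in> I \<and> y \<bullet> x \<in> I)"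

lemma mul_zero_left [simp]: "0 \<bullet> x = 0"
  using mul_add_left[of 0 0 x] by simp

lemma mul_zero_right [simp]: "x \<bullet> 0 = 0"
  using mul_add_right[of x 0 0] by simp

lemma mem_coset: "(z :: 'a) \<in> coset I x \<longleftrightarrow> z - x \<in> I"
proof
  show "z - x \<in> I" if "z \<in> coset I x" using that by (auto simp: coset_def add.commute[of x])
  show "z \<in> coset I x" if "z - x \<in> I"
    unfolding coset_def by (rule image_eqI[OF _ that]) simp
qed

lemma coset_eq_iff:
  assumes "subspace I"
  shows "coset I x = coset I y \<longleftrightarrow> x - y \<in> I"
proof
  assume "coset I x = coset I y"
  moreover have "x \<in> coset I x" using assms by (simp add: mem_coset subspace_0)
  ultimately show "x - y \<in> I" by (simp add: mem_coset)
next
  assume xy: "x - y \<in> I"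
  have "z - x \<in> I \<longleftrightarrow> z - y \<in> I" for z
  proof
    assume "z - x \<in> I"
    from subspace_add[OF assms this xy] show "z - y \<in> I" by simp
  next
    assume "z - y \<in> I"
    from subspace_diff[OF assms this xy] show "z - x \<in> I" by simp
  qed
  then show "coset I x = coset I y" by (auto simp: mem_coset)
qed

lemma coset_zero: "coset I (0 :: 'a) = I"
  by (auto simp: mem_coset)

lemma coset_mul_coset:
  assumes "is_ideal I"
  shows "coset_mul mul I (coset I x) (coset I y) = coset I (x \<bullet> y)"
proof -
  have sub: "subspace I" using assms by (simp add: is_ideal_def)
  have "coset I (a \<bullet> b) = coset I (x \<bullet> y)" if "a - x \<in> I" "b - y \<in> I" for a b
  proof -
    have "a \<bullet> b = (a - x) \<bullet> b + x \<bullet> b"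
      using mul_add_left[of "a - x" x b] by simp
    moreover have "x \<bullet> b = x \<bullet> (b - y) + x \<bullet> y"
      using mul_add_right[of x "b - y" y] by simp
    ultimately have "a \<bullet> b - x \<bullet> y = (a - x) \<bullet> b + x \<bullet> (b - y)"
      by simp
    moreover have "(a - x) \<bullet> b \<in> I" "x \<bullet> (b - y) \<in> I"
      using that assms by (simp_all add: is_ideal_def)
    ultimately have "a \<bullet> b - x \<bullet> y \<in> I" using subspace_add[OF sub] by simp
    then show ?thesis using sub by (simp add: coset_eq_iff)
  qed
  then have const: "coset I (a \<bullet> b) = coset I (x \<bullet> y)" if "a \<in> coset I x" "b \<in> coset I y" for a b
    using that by (simp only: mem_coset)
  have mem: "x \<in> coset I x" "y \<in> coset I y"
    using subspace_0[OF sub] by (simp_all add: mem_coset)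
  show ?thesis
    unfolding coset_mul_def
  proof (intro subset_antisym UN_least)
    show "coset I (a \<bullet> b) \<subseteq> coset I (x \<bullet> y)" if "a \<in> coset I x" "b \<in> coset I y" for a b
      using const[OF that] by (rule equalityD1)
    show "coset I (x \<bullet> y) \<subseteq> (\<Union>a\<in>coset I x. \<Union>b\<in>coset I y. coset I (a \<bullet> b))"
      using mem by (intro subsetI UN_I)
  qed
qed

lemma coset_mem_quotient_annihilator:
  assumes "is_ideal I"
  shows "coset I x \<in> quotient_annihilator mul I \<longleftrightarrow> (\<forall>y. x \<bullet> y \<in> I)"
proof -
  have "coset I z = I \<longleftrightarrow> z \<in> I" for z
    using coset_eq_iff[of I z 0] assms by (simp add: is_ideal_def coset_zero)
  then show ?thesis
    using assms by (simp add: quotient_annihilator_def annihilator_def coset_mul_coset)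
qed

lemma upper_ann_1: "upper_ann mul (Suc 0) = annihilator UNIV mul 0"
proof -
  have "is_ideal {0}" by (simp add: is_ideal_def)
  then show ?thesis by (simp add: coset_mem_quotient_annihilator annihilator_def)
qed

lemma upper_ann_quotient:
  "coset (upper_ann mul i) ` upper_ann mul (Suc i) = quotient_annihilator mul (upper_ann mul i)"
  unfolding upper_ann.simps by (auto simp only: quotient_annihilator_def annihilator_def)

lemma upper_ann_ideal:
  assumes comm: "\<And>x y. x \<bullet> y = y \<bullet> x"
  shows "is_ideal (upper_ann mul i) \<and> upper_ann mul i \<subseteq> upper_ann mul (Suc i)"
proof (induction i)
  case 0
  have "is_ideal {0}" by (simp add: is_ideal_def)
  then show ?case by (simp add: coset_mem_quotient_annihilator)
next
  case (Suc i)
  define I where "I = upper_ann mul i"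
  have I: "is_ideal I" "I \<subseteq> upper_ann mul (Suc i)" and sub: "subspace I"
    using Suc by (simp_all add: I_def is_ideal_def)
  have eq: "upper_ann mul (Suc i) = {x. \<forall>y. x \<bullet> y \<in> I}"
    using I(1) by (simp add: I_def coset_mem_quotient_annihilator)
  have J: "is_ideal (upper_ann mul (Suc i))"
    unfolding is_ideal_def
  proof (intro conjI ballI allI)
    show "subspace (upper_ann mul (Suc i))"
      unfolding eq using sub
      by (auto intro!: subspaceI simp: mul_add_left mul_scale_left subspace_0 subspace_add subspace_scale)
  next
    fix x y assume "x \<in> upper_ann mul (Suc i)"
    then have "x \<bullet> y \<in> I" by (simp add: eq del: upper_ann.simps)
    then show "x \<bullet> y \<in> upper_ann mul (Suc i)" using I(2) by blast
    then show "y \<bullet> x \<in> upper_ann mul (Suc i)" by (simp only: comm[of y x])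
  qed
  have "upper_ann mul (Suc (Suc i)) = {x. \<forall>y. x \<bullet> y \<in> upper_ann mul (Suc i)}"
    using coset_mem_quotient_annihilator[OF J] by (subst upper_ann.simps(2)) blast
  then show ?case using J I(2) eq by blast
qed

lemma upper_ann_unique:
  assumes comm: "\<And>x y. x \<bullet> y = y \<bullet> x"
    and S: "subspace S" "upper_ann mul i \<subseteq> S"
    and quot: "coset (upper_ann mul i) ` S = quotient_annihilator mul (upper_ann mul i)"
  shows "S = upper_ann mul (Suc i)"
proof
  show "S \<subseteq> upper_ann mul (Suc i)"
    unfolding upper_ann.simps using quot by blast
  show "upper_ann mul (Suc i) \<subseteq> S"
  proof
    fix x assume "x \<in> upper_ann mul (Suc i)"
    then have "coset (upper_ann mul i) x \<in> coset (upper_ann mul i) ` S"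
      unfolding upper_ann.simps quot by blast
    then obtain s where s: "s \<in> S" "coset (upper_ann mul i) x = coset (upper_ann mul i) s"
      by blast
    have "subspace (upper_ann mul i)"
      using upper_ann_ideal[OF comm] by (simp add: is_ideal_def)
    then have "x - s \<in> S" using s(2) S(2) coset_eq_iff by blast
    then show "x \<in> S" using subspace_add[OF S(1) _ s(1), of "x - s"] by simp
  qed
qed

end

lemma (in evolution_algebra) mul_commute: "x \<bullet> y = y \<bullet> x"
proof -
  have basis: "e i \<bullet> e j = e j \<bullet> e i" if "i \<in> \<Lambda>" "j \<in> \<Lambda>" for i j
    using that by (cases "i = j") (simp_all add: mul_distinct)
  have x: "x \<in> span (e ` \<Lambda>)" and y: "y \<in> span (e ` \<Lambda>)" by (simp_all add: basis_span)
  have step: "u \<bullet> e j = e j \<bullet> u" if "u \<in> span (e ` \<Lambda>)" "j \<in> \<Lambda>" for u j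
    using that(1)
    by (induction rule: span_induct_alt)
      (auto simp: mul_add_left mul_add_right mul_scale_left mul_scale_right basis that(2))
  show ?thesis using y
    by (induction rule: span_induct_alt)
      (auto simp: mul_add_left mul_add_right mul_scale_left mul_scale_right step[OF x])
qed

end

theory Submission
  imports Defs
begin

text \<open>Since evolution algebras are commutative, every term of the upper annihilating series is an
  ideal, and \<open>ann\<^sup>(\<^sup>n\<^sup>+\<^sup>1\<^sup>) = {x. x A \<subseteq> ann\<^sup>(\<^sup>n\<^sup>)}\<close>. The theorem follows by induction on \<open>n\<close>. Suppose that
  \<open>ann\<^sup>(\<^sup>n\<^sup>)\<close> is spanned by the \<open>e j\<close> with \<open>j \<in> L\<close>, and write \<open>x = (\<Sum>k\<in>\<Lambda>. c k *s e k)\<close>. As \<open>x \<bullet> e j\<close>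
  equals \<open>c j *s (e j \<bullet> e j)\<close>, it lies in the span of \<open>e ` L\<close> exactly if \<open>c j * w j k = 0\<close> for all
  \<open>k \<notin> L\<close> (\<open>combination_in_span_iff\<close>), that is, if \<open>c j = 0\<close> or all first-generation descendants of
  \<open>j\<close> belong to \<open>L\<close>. Hence \<open>x A \<subseteq> ann\<^sup>(\<^sup>n\<^sup>)\<close> if and only if \<open>x\<close> is a combination of the \<open>e j\<close> such that
  the descendants of \<open>j\<close> all belong to \<open>L\<close>.

  The induction can start at \<open>0\<close>: both \<open>ann\<^sup>(\<^sup>0\<^sup>) = {0}\<close> and the span of the empty set
  are zero, and \<open>e j \<bullet> e j = 0\<close> says that \<open>j\<close> has no descendants, so that the recursion for the sets
  \<open>\<lambda>\<^sub>k(B)\<close> is also valid in the step from \<open>0\<close> to \<open>1\<close> if \<open>\<lambda>\<^sub>0(B) = {}\<close>.\<close>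

context evolution_algebra
begin

lemma basis_expansion:
  obtains c where "x = (\<Sum>k\<in>\<Lambda>. c k *s e k)"
proof -
  have "x \<in> span (e ` \<Lambda>)"
    by (simp add: basis_span)
  then obtain u where "x = (\<Sum>v\<in>e ` \<Lambda>. u v *s v)"
    using span_finite[of "e ` \<Lambda>"] finite_index by auto
  then have "x = (\<Sum>k\<in>\<Lambda>. u (e k) *s e k)"
    by (simp add: sum.reindex[OF basis_inj])
  then show thesis by (rule that)
qed

lemma combination_zeroD:
  assumes "(\<Sum>k\<in>\<Lambda>. c k *s e k) = 0" and "j \<in> \<Lambda>"
  shows "c j = 0"
proof -
  have "(\<Sum>v\<in>e ` \<Lambda>. c (inv_into \<Lambda> e v) *s v) = (\<Sum>k\<in>\<Lambda>. c k *s e k)"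
    by (simp add: sum.reindex[OF basis_inj] inv_into_f_f[OF basis_inj])
  then have "c (inv_into \<Lambda> e (e j)) = 0"
    using independentD[OF basis_independent, of "e ` \<Lambda>" "\<lambda>v. c (inv_into \<Lambda> e v)" "e j"]
      finite_index assms by simp
  then show ?thesis
    using assms(2) by (simp add: inv_into_f_f[OF basis_inj])
qed

lemma combination_in_span_iff:
  assumes "S \<subseteq> \<Lambda>"
  shows "(\<Sum>k\<in>\<Lambda>. c k *s e k) \<in> span (e ` S) \<longleftrightarrow> (\<forall>k\<in>\<Lambda> - S. c k = 0)"
proof
  assume "(\<Sum>k\<in>\<Lambda>. c k *s e k) \<in> span (e ` S)"
  moreover have "finite S" "inj_on e S"
    using assms finite_index basis_inj by (auto intro: finite_subset inj_on_subset)
  ultimately obtain u where u: "(\<Sum>k\<in>\<Lambda>. c k *s e k) = (\<Sum>k\<in>S. u (e k) *s e k)"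
    using span_finite[of "e ` S"] by (auto simp: sum.reindex)
  define d where "d k = (if k \<in> S then u (e k) else 0)" for k
  have "(\<Sum>k\<in>S. u (e k) *s e k) = (\<Sum>k\<in>\<Lambda>. d k *s e k)"
    using assms finite_index by (intro sum.mono_neutral_cong_left) (auto simp: d_def)
  then have "(\<Sum>k\<in>\<Lambda>. (c k - d k) *s e k) = 0"
    by (simp add: u scale_left_diff_distrib sum_subtractf)
  then have "c k - d k = 0" if "k \<in> \<Lambda>" for k
    using that by (rule combination_zeroD)
  then show "\<forall>k\<in>\<Lambda> - S. c k = 0"
    by (simp add: d_def)
next
  assume zero: "\<forall>k\<in>\<Lambda> - S. c k = 0"
  show "(\<Sum>k\<in>\<Lambda>. c k *s e k) \<in> span (e ` S)"
  proof (rule span_sum)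
    fix k assume "k \<in> \<Lambda>"
    then show "c k *s e k \<in> span (e ` S)"
      using zero by (cases "k \<in> S") (auto intro: span_scale span_base simp: span_zero)
  qed
qed

lemma sum_mul_left: "(\<Sum>k\<in>K. f k) \<bullet> y = (\<Sum>k\<in>K. f k \<bullet> y)"
  by (induction K rule: infinite_finite_induct) (simp_all add: mul_add_left)

lemma combination_mul_basis:
  assumes "j \<in> \<Lambda>"
  shows "(\<Sum>k\<in>\<Lambda>. c k *s e k) \<bullet> e j = (\<Sum>k\<in>\<Lambda>. (c j * w j k) *s e k)"
proof -
  have "(\<Sum>k\<in>\<Lambda>. c k *s e k) \<bullet> e j = (\<Sum>k\<in>\<Lambda>. if k = j then c j *s (e j \<bullet> e j) else 0)"
    using assms by (auto simp: sum_mul_left mul_scale_left mul_distinct intro!: sum.cong)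
  also have "\<dots> = c j *s (e j \<bullet> e j)"
    using assms finite_index by simp
  finally show ?thesis
    using assms by (simp add: mul_same scale_sum_right)
qed

lemma mul_in_subspace_iff_basis:
  assumes "subspace S"
  shows "(\<forall>y. x \<bullet> y \<in> S) \<longleftrightarrow> (\<forall>j\<in>\<Lambda>. x \<bullet> e j \<in> S)"
proof
  assume basis: "\<forall>j\<in>\<Lambda>. x \<bullet> e j \<in> S"
  have "subspace {y. x \<bullet> y \<in> S}"
    using assms by (auto intro!: subspaceI
      simp: mul_add_right mul_scale_right subspace_0 subspace_add subspace_scale)
  then have "span (e ` \<Lambda>) \<subseteq> {y. x \<bullet> y \<in> S}"
    using basis by (intro span_minimal) auto
  then show "\<forall>y. x \<bullet> y \<in> S"
    by (auto simp: basis_span)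
qed simp

lemma upper_ann_Suc_iff: "x \<in> upper_ann mul (Suc n) \<longleftrightarrow> (\<forall>y. x \<bullet> y \<in> upper_ann mul n)"
  using upper_ann_ideal[OF mul_commute] by (simp add: coset_mem_quotient_annihilator)

lemma square_eq_0_iff:
  assumes "j \<in> \<Lambda>"
  shows "e j \<bullet> e j = 0 \<longleftrightarrow> descendants1 \<Lambda> w j = {}"
  using combination_in_span_iff[of "{}" "w j"] assms by (auto simp: mul_same descendants1_def)

lemma level_set_Suc:
  "level_set mul \<Lambda> e w (Suc n) = {j \<in> \<Lambda>. descendants1 \<Lambda> w j \<subseteq> level_set mul \<Lambda> e w n}"
  by (cases n) (auto simp: square_eq_0_iff)

lemma level_set_subset: "level_set mul \<Lambda> e w n \<subseteq> \<Lambda>"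
proof (cases n)
  case (Suc m)
  then show ?thesis by (auto simp only: level_set_Suc)
qed simp

theorem upper_ann_eq_span_level_set: "upper_ann mul n = span (e ` level_set mul \<Lambda> e w n)"
proof (induction n)
  case 0
  show ?case by simp
next
  case (Suc n)
  let ?L = "level_set mul \<Lambda> e w"
  show ?case
  proof (rule set_eqI)
    fix x
    obtain c where x: "x = (\<Sum>k\<in>\<Lambda>. c k *s e k)"
      by (rule basis_expansion)
    have "x \<in> upper_ann mul (Suc n) \<longleftrightarrow> (\<forall>j\<in>\<Lambda>. x \<bullet> e j \<in> span (e ` ?L n))"
      by (simp only: upper_ann_Suc_iff Suc.IH mul_in_subspace_iff_basis[OF subspace_span])
    also have "\<dots> \<longleftrightarrow> (\<forall>j\<in>\<Lambda>. \<forall>k\<in>\<Lambda> - ?L n. c j * w j k = 0)"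
      by (simp add: x combination_mul_basis combination_in_span_iff[OF level_set_subset])
    also have "\<dots> \<longleftrightarrow> (\<forall>j\<in>\<Lambda> - ?L (Suc n). c j = 0)"
      unfolding level_set_Suc descendants1_def mult_eq_0_iff by blast
    also have "\<dots> \<longleftrightarrow> x \<in> span (e ` ?L (Suc n))"
      unfolding x by (rule combination_in_span_iff[OF level_set_subset, symmetric])
    finally show "x \<in> upper_ann mul (Suc n) \<longleftrightarrow> x \<in> span (e ` ?L (Suc n))" .
  qed
qed

end

theorem proposition3p4:
  fixes scale :: "'k::field \<Rightarrow> 'a::ab_group_add \<Rightarrow> 'a"
    and mul :: "'a \<Rightarrow> 'a \<Rightarrow> 'a"
    and \<Lambda> :: "'i set" and e :: "'i \<Rightarrow> 'a" and w :: "'i \<Rightarrow> 'i \<Rightarrow> 'k"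
    and i :: nat
  assumes "evolution_algebra scale mul \<Lambda> e w"
    and "i \<ge> 1"
  shows "upper_ann mul i = module.span scale (e ` level_set mul \<Lambda> e w i)"
  using assms(1) by (rule evolution_algebra.upper_ann_eq_span_level_set)

end
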